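(* Let $(n_1)_{n}$, $(n_2)_{n}$ be sequences of natural numbers with $n_1+n_2=n$ for all $n$ and $\lim_{n\to\infty}\frac{n_2}{n}=d\in(0,1)$. Let $0\in\Theta_n\subset\mathbb R$ for all $n$ and $\Theta_n\uparrow\Theta$ as $n\to\infty$. Let $E_{1,n}=(\Omega_{1,n},\mathcal A_{1,n},\{P_{n,\vartheta}:\vartheta\in\Theta_n\})$ and $E_{2,n}=(\Omega_{2,n},\mathcal A_{2,n},\{Q_{n,\vartheta}:\vartheta\in\Theta_n\})$ be two sequences of experiments such that, for $i=1,2$, $(E_{i,n})_{n}$ is LAN with central sequence $(X_{i,n})_{n}$. Then the sequence of product experiments $$E_n=\bigl(\Omega_{1,n_1}\times\Omega_{2,n_2},\ \mathcal A_{1,n_1}\otimes\mathcal A_{2,n_2},\ \{P_{n_1,\vartheta}\otimes Q_{n_2,\vartheta}:\vartheta\in\Theta_{n_1}\cap\Theta_{n_2}\}\bigr)$$ is LAN with central sequence $$X_n:\Omega_{1,n_1}\times\Omega_{2,n_2}\to\mathbb R,\qquad (\omega_{1,n_1},\omega_{2,n_2})\mapsto X_{1,n_1}(\omega_{1,n_1})+X_{2,n_2}(\omega_{2,n_2}).$$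
   Context: $\frac{dP}{dQ}$ denotes the density quotient of probability measures: a measurable $L\ge0$ with values in $[0,\infty]$, $P(A)=\int_A L\,dQ+P(A\cap\{L=\infty\})$ for all measurable $A$, and $Q(L<\infty)=1$. A sequence of experiments $E_n=(\Omega_n,\mathcal A_n,\{P_{n,\vartheta}:\vartheta\in\Theta_n\})$ with $0\in\Theta_n\subset\mathbb R$ exhausting $\Theta$ (every $\vartheta\in\Theta$ lies in $\Theta_n$ for all sufficiently large $n$) is called LAN (locally asymptotically normal) with central sequence $(X_n)$ if $X_n:\Omega_n\to\mathbb R$ are random variables and there are $\sigma>0$ and random variables $R_{n,\vartheta}:\Omega_n\to[-\infty,\infty]$ such that: (1) $\log\frac{dP_{n,\vartheta}}{dP_{n,0}}=\vartheta X_n-\frac12\vartheta^2\sigma^2+R_{n,\vartheta}$; (2) the law $\mathcal L(X_n\mid P_{n,0})$ converges weakly to $N(0,\sigma^2)$; (3) $\lim_{n\to\infty}P_{n,0}(|R_{n,\vartheta}|>\varepsilon)=0$ for all $\varepsilon>0$ and all $\vartheta\in\Theta$. $\Theta_n\uparrow\Theta$ means that the sets increase with union $\Theta$. *)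

theory Defs
  imports "HOL-Probability.Probability"
begin

text \<open>The measure \<open>M\<close> only serves as a measurable space \<open>(\<Omega>, \<A>)\<close>: its values as a
  measure are irrelevant.\<close>

definition stat_experiment :: "'a measure \<Rightarrow> real set \<Rightarrow> (real \<Rightarrow> 'a measure) \<Rightarrow> bool" where
  "stat_experiment M \<Theta> P \<longleftrightarrow> (\<forall>\<theta>\<in>\<Theta>. prob_space (P \<theta>) \<and> sets (P \<theta>) = sets M)"

text \<open>\<open>L\<close> is a version of the density quotient \<open>dP/dQ\<close> of two probability measures on the
  same measurable space; it is determined only up to \<open>(P + Q)\<close>-null sets, hence a predicate.\<close>

definition density_quotient :: "'a measure \<Rightarrow> 'a measure \<Rightarrow> ('a \<Rightarrow> ennreal) \<Rightarrow> bool" where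
  "density_quotient P Q L \<longleftrightarrow>
     L \<in> borel_measurable Q \<and>
     (\<forall>A\<in>sets Q. emeasure P A =
        (\<integral>\<^sup>+\<omega>\<in>A. L \<omega> \<partial>Q) + emeasure P (A \<inter> {\<omega> \<in> space Q. L \<omega> = \<infinity>})) \<and>
     emeasure Q {\<omega> \<in> space Q. L \<omega> < \<infinity>} = 1"

definition ext_ln :: "ennreal \<Rightarrow> ereal" where
  "ext_ln x = (if x = 0 then - \<infinity> else if x = \<infinity> then \<infinity> else ereal (ln (enn2real x)))"

text \<open>In the equation for the log-likelihood ratio, \<open>dP/dQ\<close> is some version \<open>L\<close> and the
  equation holds pointwise. Passing to another version changes \<open>R n \<theta>\<close> only on a
  \<open>P n 0\<close>-null set, so asking this for every version (with \<open>R n \<theta>\<close> depending on it), or for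
  every version almost everywhere, gives the same notion. The sum \<open>ereal _ + R n \<theta> \<omega>\<close> has a
  finite first summand, so the convention for \<open>\<infinity> - \<infinity>\<close> plays no role.\<close>

definition LAN ::
  "(nat \<Rightarrow> 'a measure) \<Rightarrow> (nat \<Rightarrow> real set) \<Rightarrow> real set \<Rightarrow> (nat \<Rightarrow> real \<Rightarrow> 'a measure) \<Rightarrow>
   (nat \<Rightarrow> 'a \<Rightarrow> real) \<Rightarrow> bool" where
  "LAN M \<Theta>n \<Theta> P X \<longleftrightarrow>
     (\<forall>n. stat_experiment (M n) (\<Theta>n n) (P n)) \<and>
     (\<forall>n. 0 \<in> \<Theta>n n) \<and>
     (\<forall>\<theta>\<in>\<Theta>. \<forall>\<^sub>F n in sequentially. \<theta> \<in> \<Theta>n n) \<and>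
     (\<forall>n. X n \<in> borel_measurable (M n)) \<and>
     (\<exists>\<sigma>>0. \<exists>R :: nat \<Rightarrow> real \<Rightarrow> 'a \<Rightarrow> ereal.
        (\<forall>n. \<forall>\<theta>\<in>\<Theta>n n. R n \<theta> \<in> borel_measurable (M n)) \<and>
        (\<forall>n. \<forall>\<theta>\<in>\<Theta>n n. \<exists>L. density_quotient (P n \<theta>) (P n 0) L \<and>
           (\<forall>\<omega>\<in>space (M n).
              ext_ln (L \<omega>) = ereal (\<theta> * X n \<omega> - 1 / 2 * \<theta>\<^sup>2 * \<sigma>\<^sup>2) + R n \<theta> \<omega>)) \<and>
        weak_conv_m (\<lambda>n. distr (P n 0) borel (X n)) (density lborel (normal_density 0 \<sigma>)) \<and>
        (\<forall>\<epsilon>>0. \<forall>\<theta>\<in>\<Theta>.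
           (\<lambda>n. measure (P n 0) {\<omega> \<in> space (M n). \<bar>R n \<theta> \<omega>\<bar> > ereal \<epsilon>}) \<longlonglongrightarrow> 0))"

end

theory Submission
  imports Defs
begin

text \<open>
  If both quotients are finite, the density quotient of the product measures is the product of the
  quotients, and the set where one of them is infinite is null under the product measure at \<open>0\<close>.
  Hence the log-likelihood ratios add up, with
  \<open>\<sigma>\<^sup>2 = \<sigma>\<^sub>1\<^sup>2 + \<sigma>\<^sub>2\<^sup>2\<close> and remainder \<open>R\<^sub>1 + R\<^sub>2\<close>. The laws of the sums converge by Levy's
  continuity theorem, since characteristic functions of independent sums multiply. The condition
  \<open>0 < d < 1\<close> only serves to make both sample sizes tend to infinity.
\<close>

section \<open>Sums of independent coordinates\<close>

text \<open>Mirror image of \<open>prob_space.distr_pair_fst\<close>: the preimage of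
  \<open>A\<close> is the cylinder \<open>space M \<times> A\<close>, and \<open>M\<close> has total
  mass 1.\<close>

lemma distr_pair_snd:
  assumes "prob_space M" "prob_space N"
  shows "distr (M \<Otimes>\<^sub>M N) N snd = N"
proof (intro measure_eqI)
  interpret M: prob_space M by fact
  interpret N: prob_space N by fact
  fix A assume A: "A \<in> sets (distr (M \<Otimes>\<^sub>M N) N snd)"
  then have "emeasure (distr (M \<Otimes>\<^sub>M N) N snd) A = emeasure (M \<Otimes>\<^sub>M N) (space M \<times> A)"
    by (auto simp: emeasure_distr space_pair_measure dest: sets.sets_into_space
        intro!: arg_cong2[where f=emeasure])
  with A show "emeasure (distr (M \<Otimes>\<^sub>M N) N snd) A = emeasure N A"
    by (simp add: N.emeasure_pair_measure_Times M.emeasure_space_1)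
qed simp

context
  fixes M :: "'a measure" and N :: "'b measure" and f :: "'a \<Rightarrow> 'c" and g :: "'b \<Rightarrow> 'c"
    and S T :: "'c measure"
  assumes MN: "prob_space M" "prob_space N"
    and f: "f \<in> measurable M S" and g: "g \<in> measurable N T"
begin

lemma distr_pair_comp_fst: "distr (M \<Otimes>\<^sub>M N) S (\<lambda>x. f (fst x)) = distr M S f"
  using prob_space.distr_pair_fst[OF MN(2), of M] f distr_distr[of f M S fst "M \<Otimes>\<^sub>M N"]
  by (simp add: comp_def)

lemma distr_pair_comp_snd: "distr (M \<Otimes>\<^sub>M N) T (\<lambda>x. g (snd x)) = distr N T g"
  using distr_pair_snd[OF MN] g distr_distr[of g N T snd "M \<Otimes>\<^sub>M N"] by (simp add: comp_def)

text \<open>Independence amounts to the joint law being the product of the marginal laws, and the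
  image of a product measure under a product map is the product of the images. Both maps take values
  in one type \<open>'c\<close> because \<open>indep_var\<close> treats them as a family indexed by
  \<open>bool\<close>.\<close>

lemma indep_var_pair:
  "prob_space.indep_var (M \<Otimes>\<^sub>M N) S (\<lambda>x. f (fst x)) T (\<lambda>x. g (snd x))"
proof -
  interpret M: prob_space M by (rule MN)
  interpret N: prob_space N by (rule MN)
  interpret MN: pair_prob_space M N ..
  have "distr M S f \<Otimes>\<^sub>M distr N T g =
      distr (M \<Otimes>\<^sub>M N) (S \<Otimes>\<^sub>M T) (\<lambda>x. (f (fst x), g (snd x)))"
    using pair_measure_distr[OF f g] N.prob_space_distr[OF g]
    by (simp add: case_prod_unfold prob_space_imp_sigma_finite)
  then show ?thesis
    unfolding MN.indep_var_distribution_eq distr_pair_comp_fst distr_pair_comp_snd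
    using f g by auto
qed

end

section \<open>Characteristic functions and normal limits of independent sums\<close>

lemma char_distr_pair_add:
  fixes f :: "'a \<Rightarrow> real" and g :: "'b \<Rightarrow> real"
  assumes MN: "prob_space M" "prob_space N"
    and f: "f \<in> borel_measurable M" and g: "g \<in> borel_measurable N"
  shows "char (distr (M \<Otimes>\<^sub>M N) borel (\<lambda>(x, y). f x + g y)) t =
    char (distr M borel f) t * char (distr N borel g) t"
  using prob_space.char_distr_add[OF prob_space_pair[OF MN] indep_var_pair[OF MN f g], of t]
  by (simp add: distr_pair_comp_fst[OF MN f g] distr_pair_comp_snd[OF MN f g] case_prod_unfold)

lemma real_distribution_normal:
  "0 < \<sigma> \<Longrightarrow> real_distribution (density lborel (normal_density \<mu> \<sigma>))"
  using prob_space_normal_density by (auto simp: real_distribution_def real_distribution_axioms_def)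

text \<open>No characteristic function is computed. The two normal laws are realised as the
  coordinates of a product space, where \<open>add_indep_normal\<close> gives the law of the sum;
  its characteristic function is then evaluated as a product.\<close>

lemma char_normal_mult:
  assumes pos: "0 < \<sigma>" "0 < \<tau>"
  shows "char (density lborel (normal_density \<mu> \<sigma>)) t * char (density lborel (normal_density \<nu> \<tau>)) t =
    char (density lborel (normal_density (\<mu> + \<nu>) (sqrt (\<sigma>\<^sup>2 + \<tau>\<^sup>2)))) t"
proof -
  define M where "M = density lborel (\<lambda>x. ennreal (normal_density \<mu> \<sigma> x))"
  define N where "N = density lborel (\<lambda>x. ennreal (normal_density \<nu> \<tau> x))"
  have MN: "prob_space M" "prob_space N"
    using pos by (simp_all add: M_def N_def prob_space_normal_density)
  have meas: "(\<lambda>x. x) \<in> borel_measurable M" "(\<lambda>x. x) \<in> borel_measurable N"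
    by (simp_all add: M_def N_def)
  \<comment> \<open>\<open>distributed\<close> refers to \<open>lborel\<close>, the characteristic
    functions to laws on \<open>borel\<close>. Both have the same measurable sets, so the identity
    map yields the same law with either target.\<close>
  have "distr M lborel (\<lambda>x. x) = M" "distr N lborel (\<lambda>x. x) = N"
    by (simp_all add: M_def N_def distr_id2)
  then have "distr (M \<Otimes>\<^sub>M N) lborel fst = M" "distr (M \<Otimes>\<^sub>M N) lborel snd = N"
    using distr_pair_comp_fst[OF MN, of "\<lambda>x. x" lborel "\<lambda>x. x" lborel]
      distr_pair_comp_snd[OF MN, of "\<lambda>x. x" lborel "\<lambda>x. x" lborel] meas by simp_all
  moreover have "fst \<in> borel_measurable (M \<Otimes>\<^sub>M N)" "snd \<in> borel_measurable (M \<Otimes>\<^sub>M N)"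
    using meas by measurable
  ultimately have "distributed (M \<Otimes>\<^sub>M N) lborel fst (normal_density \<mu> \<sigma>)"
    "distributed (M \<Otimes>\<^sub>M N) lborel snd (normal_density \<nu> \<tau>)"
    by (simp_all add: distributed_def M_def N_def)
  then have "distributed (M \<Otimes>\<^sub>M N) lborel (\<lambda>x. fst x + snd x)
      (normal_density (\<mu> + \<nu>) (sqrt (\<sigma>\<^sup>2 + \<tau>\<^sup>2)))"
    using prob_space.add_indep_normal[OF prob_space_pair[OF MN] indep_var_pair[OF MN meas] pos]
    by simp
  then have "distr (M \<Otimes>\<^sub>M N) borel (\<lambda>(x, y). x + y) =
      density lborel (normal_density (\<mu> + \<nu>) (sqrt (\<sigma>\<^sup>2 + \<tau>\<^sup>2)))"
    by (simp add: distributed_def case_prod_unfold cong: distr_cong)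
  moreover have "distr M borel (\<lambda>x. x) = M" "distr N borel (\<lambda>x. x) = N"
    by (simp_all add: M_def N_def distr_id2)
  ultimately show ?thesis
    using char_distr_pair_add[OF MN meas, of t] by (simp add: M_def N_def)
qed

text \<open>Both directions of Levy's theorem are used: \<open>levy_continuity1\<close> turns the
  hypotheses into pointwise limits, which are multiplied, and \<open>levy_continuity\<close> returns
  to weak convergence. Only laws enter, so the underlying spaces may change with
  \<open>n\<close>.\<close>

lemma weak_conv_pair_add_normal:
  fixes X :: "nat \<Rightarrow> 'a \<Rightarrow> real" and Y :: "nat \<Rightarrow> 'b \<Rightarrow> real"
  assumes M: "\<And>n. prob_space (M n)" and N: "\<And>n. prob_space (N n)"
    and X: "\<And>n. X n \<in> borel_measurable (M n)" and Y: "\<And>n. Y n \<in> borel_measurable (N n)"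
    and pos: "0 < \<sigma>" "0 < \<tau>"
    and wX: "weak_conv_m (\<lambda>n. distr (M n) borel (X n)) (density lborel (normal_density \<mu> \<sigma>))"
    and wY: "weak_conv_m (\<lambda>n. distr (N n) borel (Y n)) (density lborel (normal_density \<nu> \<tau>))"
  shows "weak_conv_m (\<lambda>n. distr (M n \<Otimes>\<^sub>M N n) borel (\<lambda>(x, y). X n x + Y n y))
    (density lborel (normal_density (\<mu> + \<nu>) (sqrt (\<sigma>\<^sup>2 + \<tau>\<^sup>2))))"
proof (rule levy_continuity)
  show "real_distribution (distr (M n \<Otimes>\<^sub>M N n) borel (\<lambda>(x, y). X n x + Y n y))" for n
  proof (intro prob_space.real_distribution_distr prob_space_pair M N)
    note [measurable] = X[of n] Y[of n]
    show "(\<lambda>(x, y). X n x + Y n y) \<in> borel_measurable (M n \<Otimes>\<^sub>M N n)"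
      by measurable
  qed
  have "0 < sqrt (\<sigma>\<^sup>2 + \<tau>\<^sup>2)"
    using pos by (simp add: add_pos_pos)
  then show "real_distribution (density lborel (normal_density (\<mu> + \<nu>) (sqrt (\<sigma>\<^sup>2 + \<tau>\<^sup>2))))"
    by (rule real_distribution_normal)
  fix t
  have "(\<lambda>n. char (distr (M n) borel (X n)) t) \<longlonglongrightarrow> char (density lborel (normal_density \<mu> \<sigma>)) t"
    using M X pos by (intro levy_continuity1 wX real_distribution_normal
        prob_space.real_distribution_distr) auto
  moreover have "(\<lambda>n. char (distr (N n) borel (Y n)) t) \<longlonglongrightarrow>
      char (density lborel (normal_density \<nu> \<tau>)) t"
    using N Y pos by (intro levy_continuity1 wY real_distribution_normal
        prob_space.real_distribution_distr) auto
  ultimately show "(\<lambda>n. char (distr (M n \<Otimes>\<^sub>M N n) borel (\<lambda>(x, y). X n x + Y n y)) t) \<longlonglongrightarrow>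
      char (density lborel (normal_density (\<mu> + \<nu>) (sqrt (\<sigma>\<^sup>2 + \<tau>\<^sup>2)))) t"
    unfolding char_distr_pair_add[OF M N X Y] char_normal_mult[OF pos, symmetric]
    by (rule tendsto_mult)
qed

text \<open>Weak convergence is pointwise convergence of distribution functions at continuity points
  of the limit, which survives any reindexing that tends to infinity. The index map may repeat
  values or decrease, so this covers more than subsequences.\<close>

lemma weak_conv_m_compose:
  assumes "weak_conv_m \<mu> \<nu>" and "filterlim k sequentially sequentially"
  shows "weak_conv_m (\<lambda>n. \<mu> (k n)) \<nu>"
  using assms unfolding weak_conv_m_def weak_conv_def
  by (auto intro: filterlim_compose[where g="\<lambda>n. cdf (\<mu> n) x" for x])

section \<open>The density quotient of product measures\<close>

text \<open>The library convention \<open>0 * \<infinity> = 0\<close> would be wrong here: the product measure may charge the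
  set where one quotient is \<open>\<infinity>\<close> and the other one is \<open>0\<close>.\<close>

definition quot_mult :: "ennreal \<Rightarrow> ennreal \<Rightarrow> ennreal" where
  "quot_mult a b = (if a = \<infinity> \<or> b = \<infinity> then \<infinity> else a * b)"

lemma measurable_quot_mult [measurable]:
  assumes [measurable]: "f \<in> borel_measurable M" "g \<in> borel_measurable M"
  shows "(\<lambda>x. quot_mult (f x) (g x)) \<in> borel_measurable M"
  unfolding quot_mult_def by measurable

text \<open>This makes the finiteness set of the combined quotient a rectangle, whose product
  measure factorises.\<close>

lemma quot_mult_less_top_iff: "quot_mult a b < \<infinity> \<longleftrightarrow> a < \<infinity> \<and> b < \<infinity>"
  by (auto simp: quot_mult_def ennreal_mult_less_top less_top)

text \<open>Sums of extended reals follow the convention \<open>\<infinity> + (- \<infinity>) = \<infinity>\<close>, which matches that of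
  \<^const>\<open>quot_mult\<close>.\<close>

lemma ext_ln_quot_mult: "ext_ln (quot_mult a b) = ext_ln a + ext_ln b"
proof -
  consider "a = \<infinity> \<or> b = \<infinity>" | "a \<noteq> \<infinity>" "b \<noteq> \<infinity>" "a = 0 \<or> b = 0" |
    "a \<noteq> \<infinity>" "b \<noteq> \<infinity>" "a \<noteq> 0" "b \<noteq> 0" by blast
  then show ?thesis
  proof cases
    case 3
    then have "0 < enn2real a" "0 < enn2real b"
      by (simp_all add: enn2real_positive_iff less_top zero_less_iff_neq_zero)
    with 3 show ?thesis
      by (auto simp: ext_ln_def quot_mult_def enn2real_mult ln_mult ennreal_mult_eq_top_iff)
  qed (auto simp: ext_ln_def quot_mult_def)
qed

text \<open>On the set where \<open>L\<close> is finite the singular term of the defining identity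
  vanishes, so \<open>P\<close> restricted to that set has a density with respect to
  \<open>Q\<close>. Writing both sides with \<open>density\<close> prepares for
  \<open>pair_measure_density\<close>.\<close>

lemma density_quotient_imp_density_eq:
  assumes dq: "density_quotient P Q L" and sets: "sets P = sets Q"
  shows "density P (indicator {\<omega> \<in> space Q. L \<omega> < \<infinity>}) =
    density Q (\<lambda>\<omega>. L \<omega> * indicator {\<omega> \<in> space Q. L \<omega> < \<infinity>} \<omega>)"
proof (rule measure_eqI)
  let ?F = "{\<omega> \<in> space Q. L \<omega> < \<infinity>}"
  have L[measurable]: "L \<in> borel_measurable Q"
    using dq by (simp add: density_quotient_def)
  have F: "?F \<in> sets Q" by measurable
  fix A assume "A \<in> sets (density P (indicator ?F))"
  then have A: "A \<in> sets Q" by (simp add: sets)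
  have "emeasure (density P (indicator ?F)) A = emeasure P (?F \<inter> A)"
    using A F sets by (intro emeasure_restricted) simp_all
  also have "\<dots> = (\<integral>\<^sup>+\<omega>\<in>?F \<inter> A. L \<omega> \<partial>Q) + emeasure P ((?F \<inter> A) \<inter> {\<omega> \<in> space Q. L \<omega> = \<infinity>})"
    using dq sets.Int[OF F A] unfolding density_quotient_def by blast
  also have "(?F \<inter> A) \<inter> {\<omega> \<in> space Q. L \<omega> = \<infinity>} = {}" by auto
  also have "(\<integral>\<^sup>+\<omega>\<in>?F \<inter> A. L \<omega> \<partial>Q) + emeasure P {} =
      emeasure (density Q (\<lambda>\<omega>. L \<omega> * indicator ?F \<omega>)) A"
    using A F by (simp add: emeasure_density indicator_inter_arith mult.assoc)
  finally show "emeasure (density P (indicator ?F)) A =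
      emeasure (density Q (\<lambda>\<omega>. L \<omega> * indicator ?F \<omega>)) A" .
qed (simp add: sets)

text \<open>Let \<open>F\<close> and \<open>G\<close> be the sets where the two quotients are
  finite. On \<open>F \<times> G\<close> the restricted product measure is a product of two
  densities; everything outside goes into the singular term. The rectangle has full measure under
  \<open>P0\<close> times \<open>Q0\<close> since \<open>F\<close> and \<open>G\<close> do under the
  factors.\<close>

lemma density_quotient_pair:
  assumes prob: "prob_space P" "prob_space P0" "prob_space Q" "prob_space Q0"
    and sP: "sets P = sets P0" and sQ: "sets Q = sets Q0"
    and dP: "density_quotient P P0 L" and dQ: "density_quotient Q Q0 K"
  shows "density_quotient (P \<Otimes>\<^sub>M Q) (P0 \<Otimes>\<^sub>M Q0) (\<lambda>(x, y). quot_mult (L x) (K y))"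
proof -
  interpret P: prob_space P by fact
  interpret P0: prob_space P0 by fact
  interpret Q: prob_space Q by fact
  interpret Q0: prob_space Q0 by fact
  interpret PQ: pair_prob_space P Q ..
  interpret PQ0: pair_prob_space P0 Q0 ..
  let ?H = "\<lambda>(x, y). quot_mult (L x) (K y)"
  define F where "F = {x \<in> space P0. L x < \<infinity>}"
  define G where "G = {y \<in> space Q0. K y < \<infinity>}"
  have L[measurable]: "L \<in> borel_measurable P0" and K[measurable]: "K \<in> borel_measurable Q0"
    using dP dQ by (simp_all add: density_quotient_def)
  have F[measurable]: "F \<in> sets P0" and G[measurable]: "G \<in> sets Q0"
    unfolding F_def G_def by measurable
  have F': "F \<in> sets P" and G': "G \<in> sets Q"
    using F G sP sQ by simp_all
  have FG: "F \<times> G \<in> sets (P0 \<Otimes>\<^sub>M Q0)" by measurable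
  have sPQ: "sets (P \<Otimes>\<^sub>M Q) = sets (P0 \<Otimes>\<^sub>M Q0)"
    by (intro sets_pair_measure_cong sP sQ)
  have H[measurable]: "?H \<in> borel_measurable (P0 \<Otimes>\<^sub>M Q0)" by measurable
  have fin: "{\<omega> \<in> space (P0 \<Otimes>\<^sub>M Q0). ?H \<omega> < \<infinity>} = F \<times> G"
    by (auto simp: F_def G_def space_pair_measure quot_mult_less_top_iff[simplified])
  have one: "emeasure (P0 \<Otimes>\<^sub>M Q0) (F \<times> G) = 1"
  proof -
    have "emeasure P0 F = 1" "emeasure Q0 G = 1"
      using dP dQ by (simp_all add: density_quotient_def F_def G_def)
    with F G show ?thesis
      by (simp add: Q0.emeasure_pair_measure_Times)
  qed
  have AEFG: "AE \<omega> in P0 \<Otimes>\<^sub>M Q0. \<omega> \<in> F \<times> G"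
    using one by (intro PQ0.AE_prob_1) (simp add: measure_def)
  \<comment> \<open>\<open>pair_measure_density\<close> requires the second density measure to be
    sigma-finite. Here it is dominated by the probability measure \<open>Q\<close>; the same fact,
    rewritten as a density of \<open>Q0\<close>, serves when the factors are recombined.\<close>
  have fin_dens: "finite_measure (density Q (indicator G))"
    using G' by (intro finite_measureI) (simp add: emeasure_density nn_integral_indicator)
  have dens: "density (P \<Otimes>\<^sub>M Q) (indicator (F \<times> G)) =
      density (P0 \<Otimes>\<^sub>M Q0) (\<lambda>(x, y). (L x * indicator F x) * (K y * indicator G y))"
  proof -
    have "density (P \<Otimes>\<^sub>M Q) (\<lambda>(x, y). indicator F x * indicator G y) =
        density P (indicator F) \<Otimes>\<^sub>M density Q (indicator G)"
      using fin_dens F' G'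
      by (intro pair_measure_density[symmetric] Q.sigma_finite_measure_axioms
          finite_measure.axioms(1)) auto
    also have "\<dots> = density P0 (\<lambda>x. L x * indicator F x) \<Otimes>\<^sub>M density Q0 (\<lambda>y. K y * indicator G y)"
      unfolding F_def G_def density_quotient_imp_density_eq[OF dP sP]
        density_quotient_imp_density_eq[OF dQ sQ] ..
    also have "\<dots> = density (P0 \<Otimes>\<^sub>M Q0) (\<lambda>(x, y). (L x * indicator F x) * (K y * indicator G y))"
      using fin_dens unfolding G_def density_quotient_imp_density_eq[OF dQ sQ]
      by (intro pair_measure_density Q0.sigma_finite_measure_axioms finite_measure.axioms(1)) auto
    also have "(\<lambda>(x, y). indicator F x * indicator G y :: ennreal) = indicator (F \<times> G)"
      by (auto simp: fun_eq_iff split: split_indicator)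
    finally show ?thesis .
  qed
  have split: "emeasure (P \<Otimes>\<^sub>M Q) A = (\<integral>\<^sup>+\<omega>\<in>A. ?H \<omega> \<partial>(P0 \<Otimes>\<^sub>M Q0)) +
      emeasure (P \<Otimes>\<^sub>M Q) (A \<inter> {\<omega> \<in> space (P0 \<Otimes>\<^sub>M Q0). ?H \<omega> = \<infinity>})"
    if A: "A \<in> sets (P0 \<Otimes>\<^sub>M Q0)" for A
  proof -
    have "emeasure (P \<Otimes>\<^sub>M Q) ((F \<times> G) \<inter> A) = emeasure (density (P \<Otimes>\<^sub>M Q) (indicator (F \<times> G))) A"
      using A FG unfolding sPQ[symmetric] by (rule emeasure_restricted[symmetric, rotated])
    also have "\<dots> = (\<integral>\<^sup>+\<omega>\<in>A. (case \<omega> of (x, y) \<Rightarrow> (L x * indicator F x) * (K y * indicator G y))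
        \<partial>(P0 \<Otimes>\<^sub>M Q0))"
      unfolding dens using A by (simp add: emeasure_density)
    \<comment> \<open>On \<open>F \<times> G\<close> the indicators are 1 and
      \<open>quot_mult\<close> is ordinary multiplication. Outside it the integrands differ, but
      only on a null set of the base measure.\<close>
    also have "\<dots> = (\<integral>\<^sup>+\<omega>\<in>A. ?H \<omega> \<partial>(P0 \<Otimes>\<^sub>M Q0))"
      using AEFG by (intro nn_integral_cong_AE) (auto simp: F_def G_def quot_mult_def)
    finally have 1: "emeasure (P \<Otimes>\<^sub>M Q) ((F \<times> G) \<inter> A) = (\<integral>\<^sup>+\<omega>\<in>A. ?H \<omega> \<partial>(P0 \<Otimes>\<^sub>M Q0))" .
    \<comment> \<open>The complement of the rectangle is where \<open>?H\<close> is infinite. It may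
      have positive mass under \<open>P\<close> times \<open>Q\<close>, and that mass is the
      singular term.\<close>
    have "A - F \<times> G = A \<inter> {\<omega> \<in> space (P0 \<Otimes>\<^sub>M Q0). ?H \<omega> = \<infinity>}"
      unfolding fin[symmetric] using sets.sets_into_space[OF A] by (auto simp: not_less top_unique)
    moreover have "emeasure (P \<Otimes>\<^sub>M Q) A =
        emeasure (P \<Otimes>\<^sub>M Q) ((F \<times> G) \<inter> A) + emeasure (P \<Otimes>\<^sub>M Q) (A - F \<times> G)"
      using A FG sPQ by (subst plus_emeasure) (auto intro!: arg_cong2[where f=emeasure])
    ultimately show ?thesis using 1 by simp
  qed
  show ?thesis
    unfolding density_quotient_def fin using H one split by blast
qed

section \<open>The product of two LAN sequences\<close>

text \<open>By the triangle inequality, which \<open>ereal_abs_add\<close> provides for infinite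
  values too, one summand must exceed half the bound. The event is thus covered by two cylinders,
  each having the measure of its base.\<close>

lemma measure_pair_abs_add_gt_le:
  fixes R :: "'a \<Rightarrow> ereal" and S :: "'b \<Rightarrow> ereal"
  assumes P: "prob_space P" and Q: "prob_space Q"
    and R[measurable]: "R \<in> borel_measurable P" and S[measurable]: "S \<in> borel_measurable Q"
  shows "measure (P \<Otimes>\<^sub>M Q) {\<omega> \<in> space (P \<Otimes>\<^sub>M Q). \<bar>case \<omega> of (x, y) \<Rightarrow> R x + S y\<bar> > ereal \<epsilon>} \<le>
    measure P {x \<in> space P. \<bar>R x\<bar> > ereal (\<epsilon> / 2)} + measure Q {y \<in> space Q. \<bar>S y\<bar> > ereal (\<epsilon> / 2)}"
    (is "measure _ ?C \<le> measure _ ?A + measure _ ?B")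
proof -
  interpret P: prob_space P by fact
  interpret Q: prob_space Q by fact
  interpret PQ: pair_prob_space P Q ..
  have A: "?A \<in> sets P" and B: "?B \<in> sets Q" by measurable
  have "ereal (\<epsilon> / 2) < \<bar>R x\<bar> \<or> ereal (\<epsilon> / 2) < \<bar>S y\<bar>" if "ereal \<epsilon> < \<bar>R x + S y\<bar>" for x y
  proof (rule ccontr)
    assume "\<not> ?thesis"
    then have "\<bar>R x\<bar> + \<bar>S y\<bar> \<le> ereal (\<epsilon> / 2) + ereal (\<epsilon> / 2)"
      by (intro add_mono) auto
    with ereal_abs_add[of "R x" "S y"] have "\<bar>R x + S y\<bar> \<le> ereal \<epsilon>"
      by simp
    with that show False by simp
  qed
  then have "?C \<subseteq> ?A \<times> space Q \<union> space P \<times> ?B"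
    by (auto simp: space_pair_measure)
  then have "measure (P \<Otimes>\<^sub>M Q) ?C \<le> measure (P \<Otimes>\<^sub>M Q) (?A \<times> space Q \<union> space P \<times> ?B)"
    using A B by (intro PQ.finite_measure_mono) auto
  also have "\<dots> \<le> measure (P \<Otimes>\<^sub>M Q) (?A \<times> space Q) + measure (P \<Otimes>\<^sub>M Q) (space P \<times> ?B)"
    using A B by (intro measure_Un_le) auto
  also have "\<dots> = measure P ?A + measure Q ?B"
    using A B by (simp add: measure_def Q.emeasure_pair_measure_Times P.emeasure_space_1
        Q.emeasure_space_1)
  finally show ?thesis .
qed

lemma filterlim_sequentially_of_ratio:
  fixes k :: "nat \<Rightarrow> nat"
  assumes "(\<lambda>n. real (k n) / real n) \<longlonglongrightarrow> c" and "0 < c"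
  shows "filterlim k sequentially sequentially"
proof -
  have "filterlim (\<lambda>n. (real (k n) / real n) * real n) at_top sequentially"
    by (rule filterlim_tendsto_pos_mult_at_top[OF assms filterlim_real_sequentially])
  \<comment> \<open>Only eventual: at \<open>n = 0\<close> division by zero makes the left side 0,
    whatever \<open>k 0\<close> is.\<close>
  moreover have ev: "eventually (\<lambda>n. (real (k n) / real n) * real n = real (k n)) sequentially"
    using eventually_gt_at_top[of 0] by eventually_elim simp
  ultimately have "filterlim (\<lambda>n. real (k n)) at_top sequentially"
    by (simp only: filterlim_cong[OF refl refl ev])
  then show ?thesis
    by (simp add: filterlim_sequentially_iff_filterlim_real)
qed

text \<open>The sample sizes enter only through two index sequences tending to infinity, which
  separates the LAN argument from the ratio condition.\<close>

lemma LAN_pair: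
  assumes k: "filterlim k sequentially sequentially" and m: "filterlim m sequentially sequentially"
    and L1: "LAN M1 \<Theta>1 \<Theta> P X1" and L2: "LAN M2 \<Theta>2 \<Theta> Q X2"
  shows "LAN (\<lambda>n. M1 (k n) \<Otimes>\<^sub>M M2 (m n)) (\<lambda>n. \<Theta>1 (k n) \<inter> \<Theta>2 (m n)) \<Theta>
    (\<lambda>n \<theta>. P (k n) \<theta> \<Otimes>\<^sub>M Q (m n) \<theta>) (\<lambda>n (\<omega>1, \<omega>2). X1 (k n) \<omega>1 + X2 (m n) \<omega>2)"
proof -
  have prob1: "prob_space (P n \<theta>)" and sets1: "sets (P n \<theta>) = sets (M1 n)" if "\<theta> \<in> \<Theta>1 n" for n \<theta>
    using L1 that by (auto simp: LAN_def stat_experiment_def)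
  have prob2: "prob_space (Q n \<theta>)" and sets2: "sets (Q n \<theta>) = sets (M2 n)" if "\<theta> \<in> \<Theta>2 n" for n \<theta>
    using L2 that by (auto simp: LAN_def stat_experiment_def)
  have zero1: "0 \<in> \<Theta>1 n" and X1: "X1 n \<in> borel_measurable (M1 n)" for n
    using L1 by (auto simp: LAN_def)
  have zero2: "0 \<in> \<Theta>2 n" and X2: "X2 n \<in> borel_measurable (M2 n)" for n
    using L2 by (auto simp: LAN_def)
  note space1 = sets_eq_imp_space_eq[OF sets1] and space2 = sets_eq_imp_space_eq[OF sets2]
  obtain \<sigma>1 R1 where \<sigma>1: "\<sigma>1 > 0"
    and R1[rule_format]: "\<forall>n. \<forall>\<theta>\<in>\<Theta>1 n. R1 n \<theta> \<in> borel_measurable (M1 n)"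
    and quot1[rule_format]: "\<forall>n. \<forall>\<theta>\<in>\<Theta>1 n. \<exists>L. density_quotient (P n \<theta>) (P n 0) L \<and>
      (\<forall>\<omega>\<in>space (M1 n). ext_ln (L \<omega>) = ereal (\<theta> * X1 n \<omega> - 1 / 2 * \<theta>\<^sup>2 * \<sigma>1\<^sup>2) + R1 n \<theta> \<omega>)"
    and weak1: "weak_conv_m (\<lambda>n. distr (P n 0) borel (X1 n)) (density lborel (normal_density 0 \<sigma>1))"
    and lim1[rule_format]: "\<forall>\<epsilon>>0. \<forall>\<theta>\<in>\<Theta>.
      (\<lambda>n. measure (P n 0) {\<omega> \<in> space (M1 n). \<bar>R1 n \<theta> \<omega>\<bar> > ereal \<epsilon>}) \<longlonglongrightarrow> 0"
    using L1 unfolding LAN_def by (elim exE conjE) (rule that)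
  obtain \<sigma>2 R2 where \<sigma>2: "\<sigma>2 > 0"
    and R2[rule_format]: "\<forall>n. \<forall>\<theta>\<in>\<Theta>2 n. R2 n \<theta> \<in> borel_measurable (M2 n)"
    and quot2[rule_format]: "\<forall>n. \<forall>\<theta>\<in>\<Theta>2 n. \<exists>L. density_quotient (Q n \<theta>) (Q n 0) L \<and>
      (\<forall>\<omega>\<in>space (M2 n). ext_ln (L \<omega>) = ereal (\<theta> * X2 n \<omega> - 1 / 2 * \<theta>\<^sup>2 * \<sigma>2\<^sup>2) + R2 n \<theta> \<omega>)"
    and weak2: "weak_conv_m (\<lambda>n. distr (Q n 0) borel (X2 n)) (density lborel (normal_density 0 \<sigma>2))"
    and lim2[rule_format]: "\<forall>\<epsilon>>0. \<forall>\<theta>\<in>\<Theta>.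
      (\<lambda>n. measure (Q n 0) {\<omega> \<in> space (M2 n). \<bar>R2 n \<theta> \<omega>\<bar> > ereal \<epsilon>}) \<longlonglongrightarrow> 0"
    using L2 unfolding LAN_def by (elim exE conjE) (rule that)
  \<comment> \<open>One constant has to serve twice: its square is the sum of the variances in the
    quadratic term, and it is the standard deviation of the limiting normal law.\<close>
  define \<sigma> where "\<sigma> = sqrt (\<sigma>1\<^sup>2 + \<sigma>2\<^sup>2)"
  have \<sigma>: "\<sigma> > 0" and \<sigma>_sq: "\<sigma>\<^sup>2 = \<sigma>1\<^sup>2 + \<sigma>2\<^sup>2"
    using \<sigma>1 \<sigma>2 by (simp_all add: \<sigma>_def add_pos_pos)
  define R where "R n \<theta> = (\<lambda>(x, y). R1 (k n) \<theta> x + R2 (m n) \<theta> y)" for n \<theta>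
  have ev: "\<forall>\<^sub>F n in sequentially. \<theta> \<in> \<Theta>1 (k n) \<inter> \<Theta>2 (m n)" if "\<theta> \<in> \<Theta>" for \<theta>
  proof -
    have "\<forall>\<^sub>F n in sequentially. \<theta> \<in> \<Theta>1 n" "\<forall>\<^sub>F n in sequentially. \<theta> \<in> \<Theta>2 n"
      using L1 L2 that by (auto simp: LAN_def)
    then have "\<forall>\<^sub>F n in sequentially. \<theta> \<in> \<Theta>1 (k n)" "\<forall>\<^sub>F n in sequentially. \<theta> \<in> \<Theta>2 (m n)"
      using k m by (auto simp: filterlim_iff)
    then show ?thesis by eventually_elim simp
  qed
  have meas: "R n \<theta> \<in> borel_measurable (M1 (k n) \<Otimes>\<^sub>M M2 (m n))"
    if "\<theta> \<in> \<Theta>1 (k n) \<inter> \<Theta>2 (m n)" for n \<theta>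
  proof -
    have [measurable]: "R1 (k n) \<theta> \<in> borel_measurable (M1 (k n))"
      "R2 (m n) \<theta> \<in> borel_measurable (M2 (m n))"
      using that R1 R2 by auto
    show ?thesis unfolding R_def by measurable
  qed
  have quot: "\<exists>L. density_quotient (P (k n) \<theta> \<Otimes>\<^sub>M Q (m n) \<theta>) (P (k n) 0 \<Otimes>\<^sub>M Q (m n) 0) L \<and>
      (\<forall>\<omega>\<in>space (M1 (k n) \<Otimes>\<^sub>M M2 (m n)). ext_ln (L \<omega>) =
        ereal (\<theta> * (case \<omega> of (\<omega>1, \<omega>2) \<Rightarrow> X1 (k n) \<omega>1 + X2 (m n) \<omega>2) - 1 / 2 * \<theta>\<^sup>2 * \<sigma>\<^sup>2) + R n \<theta> \<omega>)"
    if \<theta>: "\<theta> \<in> \<Theta>1 (k n) \<inter> \<Theta>2 (m n)" for n \<theta>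
  proof -
    obtain L where L: "density_quotient (P (k n) \<theta>) (P (k n) 0) L"
      and L_eq: "\<And>x. x \<in> space (M1 (k n)) \<Longrightarrow>
        ext_ln (L x) = ereal (\<theta> * X1 (k n) x - 1 / 2 * \<theta>\<^sup>2 * \<sigma>1\<^sup>2) + R1 (k n) \<theta> x"
      using quot1[of \<theta> "k n"] \<theta> by blast
    obtain K where K: "density_quotient (Q (m n) \<theta>) (Q (m n) 0) K"
      and K_eq: "\<And>y. y \<in> space (M2 (m n)) \<Longrightarrow>
        ext_ln (K y) = ereal (\<theta> * X2 (m n) y - 1 / 2 * \<theta>\<^sup>2 * \<sigma>2\<^sup>2) + R2 (m n) \<theta> y"
      using quot2[of \<theta> "m n"] \<theta> by blast
    \<comment> \<open>Addition of extended reals is commutative and associative with its convention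
      for opposite infinities, so this also holds for infinite remainders.\<close>
    have regroup: "(ereal a + u) + (ereal b + v) = ereal (a + b) + (u + v)" for a b u v
      by (simp add: ac_simps flip: plus_ereal.simps(1))
    have "density_quotient (P (k n) \<theta> \<Otimes>\<^sub>M Q (m n) \<theta>) (P (k n) 0 \<Otimes>\<^sub>M Q (m n) 0)
        (\<lambda>(x, y). quot_mult (L x) (K y))"
      using \<theta> by (intro density_quotient_pair L K prob1 prob2 zero1 zero2) (auto simp: sets1 sets2 zero1 zero2)
    moreover have "ext_ln (quot_mult (L x) (K y)) =
        ereal (\<theta> * (X1 (k n) x + X2 (m n) y) - 1 / 2 * \<theta>\<^sup>2 * \<sigma>\<^sup>2) + R n \<theta> (x, y)"
      if "x \<in> space (M1 (k n))" "y \<in> space (M2 (m n))" for x y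
      unfolding ext_ln_quot_mult L_eq[OF that(1)] K_eq[OF that(2)] regroup R_def \<sigma>_sq
      by (simp add: algebra_simps)
    ultimately show ?thesis
      by (intro exI[of _ "\<lambda>(x, y). quot_mult (L x) (K y)"]) (auto simp: space_pair_measure)
  qed
  have weak: "weak_conv_m (\<lambda>n. distr (P (k n) 0 \<Otimes>\<^sub>M Q (m n) 0) borel
      (\<lambda>(\<omega>1, \<omega>2). X1 (k n) \<omega>1 + X2 (m n) \<omega>2)) (density lborel (normal_density 0 \<sigma>))"
  proof -
    have "X1 n \<in> borel_measurable (P n 0)" "X2 n \<in> borel_measurable (Q n 0)" for n
      using X1 X2 by (simp_all cong: measurable_cong_sets add: sets1 sets2 zero1 zero2)
    then show ?thesis
      using weak_conv_pair_add_normal[OF prob1[OF zero1] prob2[OF zero2] _ _ \<sigma>1 \<sigma>2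
          weak_conv_m_compose[OF weak1 k] weak_conv_m_compose[OF weak2 m]]
      by (simp add: \<sigma>_def)
  qed
  have lim: "(\<lambda>n. measure (P (k n) 0 \<Otimes>\<^sub>M Q (m n) 0)
      {\<omega> \<in> space (M1 (k n) \<Otimes>\<^sub>M M2 (m n)). \<bar>R n \<theta> \<omega>\<bar> > ereal \<epsilon>}) \<longlonglongrightarrow> 0"
    if \<epsilon>: "\<epsilon> > 0" and \<theta>: "\<theta> \<in> \<Theta>" for \<epsilon> \<theta>
  proof (rule tendsto_sandwich[OF _ _ tendsto_const])
    let ?u = "\<lambda>n. measure (P n 0) {\<omega> \<in> space (M1 n). \<bar>R1 n \<theta> \<omega>\<bar> > ereal (\<epsilon> / 2)}"
    let ?v = "\<lambda>n. measure (Q n 0) {\<omega> \<in> space (M2 n). \<bar>R2 n \<theta> \<omega>\<bar> > ereal (\<epsilon> / 2)}"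
    have "?u \<longlonglongrightarrow> 0" "?v \<longlonglongrightarrow> 0"
      using lim1[OF _ \<theta>, of "\<epsilon> / 2"] lim2[OF _ \<theta>, of "\<epsilon> / 2"] \<epsilon> by simp_all
    from filterlim_compose[OF this(1) k] filterlim_compose[OF this(2) m]
    have "(\<lambda>n. ?u (k n)) \<longlonglongrightarrow> 0" "(\<lambda>n. ?v (m n)) \<longlonglongrightarrow> 0" .
    from tendsto_add[OF this] show "(\<lambda>n. ?u (k n) + ?v (m n)) \<longlonglongrightarrow> 0" by simp
    show "\<forall>\<^sub>F n in sequentially. measure (P (k n) 0 \<Otimes>\<^sub>M Q (m n) 0)
      {\<omega> \<in> space (M1 (k n) \<Otimes>\<^sub>M M2 (m n)). \<bar>R n \<theta> \<omega>\<bar> > ereal \<epsilon>} \<le> ?u (k n) + ?v (m n)"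
      \<comment> \<open>The remainders are known to be measurable only for parameters in the current
        sets, so the bound is claimed for large \<open>n\<close>.\<close>
      using ev[OF \<theta>]
    proof eventually_elim
      case (elim n)
      have "R1 (k n) \<theta> \<in> borel_measurable (P (k n) 0)" "R2 (m n) \<theta> \<in> borel_measurable (Q (m n) 0)"
        using R1 R2 elim by (simp_all cong: measurable_cong_sets add: sets1 sets2 zero1 zero2)
      from measure_pair_abs_add_gt_le[OF prob1[OF zero1] prob2[OF zero2] this, of \<epsilon>]
      show ?case
        by (simp add: R_def space_pair_measure space1 space2 zero1 zero2)
    qed
  qed simp
  have exp: "stat_experiment (M1 (k n) \<Otimes>\<^sub>M M2 (m n)) (\<Theta>1 (k n) \<inter> \<Theta>2 (m n))
      (\<lambda>\<theta>. P (k n) \<theta> \<Otimes>\<^sub>M Q (m n) \<theta>)" for n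
    by (auto simp: stat_experiment_def intro!: prob_space_pair prob1 prob2 sets_pair_measure_cong
        sets1 sets2)
  have X: "(\<lambda>(\<omega>1, \<omega>2). X1 (k n) \<omega>1 + X2 (m n) \<omega>2) \<in> borel_measurable (M1 (k n) \<Otimes>\<^sub>M M2 (m n))" for n
    using X1[of "k n"] X2[of "m n"] by measurable
  show ?thesis
    unfolding LAN_def
    by (intro conjI allI ballI impI exI[of _ \<sigma>] exI[of _ R])
      ((rule exp X ev \<sigma> meas quot weak lim; assumption?) | simp add: zero1 zero2)+
qed

theorem mainTheorem3:
  fixes n1 n2 :: "nat \<Rightarrow> nat" and d :: real
    and \<Theta>n :: "nat \<Rightarrow> real set" and \<Theta> :: "real set"
    and M1 :: "nat \<Rightarrow> 'a measure" and M2 :: "nat \<Rightarrow> 'b measure"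
    and P :: "nat \<Rightarrow> real \<Rightarrow> 'a measure" and Q :: "nat \<Rightarrow> real \<Rightarrow> 'b measure"
    and X1 :: "nat \<Rightarrow> 'a \<Rightarrow> real" and X2 :: "nat \<Rightarrow> 'b \<Rightarrow> real"
  assumes "\<And>n. n1 n + n2 n = n"
    and "(\<lambda>n. real (n2 n) / real n) \<longlonglongrightarrow> d" and "0 < d" and "d < 1"
    and "\<And>n. 0 \<in> \<Theta>n n"
    and "incseq \<Theta>n" and "(\<Union>n. \<Theta>n n) = \<Theta>"
    and "LAN M1 \<Theta>n \<Theta> P X1"
    and "LAN M2 \<Theta>n \<Theta> Q X2"
  shows "LAN (\<lambda>n. M1 (n1 n) \<Otimes>\<^sub>M M2 (n2 n)) (\<lambda>n. \<Theta>n (n1 n) \<inter> \<Theta>n (n2 n)) \<Theta>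
           (\<lambda>n \<theta>. P (n1 n) \<theta> \<Otimes>\<^sub>M Q (n2 n) \<theta>)
           (\<lambda>n (\<omega>1, \<omega>2). X1 (n1 n) \<omega>1 + X2 (n2 n) \<omega>2)"
proof (rule LAN_pair[OF _ _ assms(8,9)])
  show "filterlim n2 sequentially sequentially"
    using assms(2,3) by (rule filterlim_sequentially_of_ratio)
  have "(\<lambda>n. 1 - real (n2 n) / real n) \<longlonglongrightarrow> 1 - d"
    by (intro tendsto_intros assms(2))
  \<comment> \<open>At \<open>n = 0\<close> the left side is 1 and the right side 0, by the
    convention for division by zero; the equality holds from 1 on.\<close>
  moreover have "\<forall>\<^sub>F n in sequentially. 1 - real (n2 n) / real n = real (n1 n) / real n"
    using eventually_gt_at_top[of 0]
  proof eventually_elim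
    case (elim n)
    have "real (n1 n) + real (n2 n) = real n"
      using assms(1)[of n] by (metis of_nat_add)
    with elim show ?case by (simp add: field_simps)
  qed
  ultimately have "(\<lambda>n. real (n1 n) / real n) \<longlonglongrightarrow> 1 - d"
    by (rule Lim_transform_eventually)
  then show "filterlim n1 sequentially sequentially"
    using assms(4) by (rule filterlim_sequentially_of_ratio[OF _ iffD2[OF diff_gt_0_iff_gt]])
qed

end
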